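(* Let $a>1$, $b>0$ and $c=2b$, and let $p_0$, $p_E$ and $A_p$ be as defined in the context. Then $$1<p_E<p_0<a.$$ Moreover, for arbitrary $\lambda,\mu\in\mathbb{R}$, $$A_\lambda\left(\tfrac12;1,1-r\right)\le {}_2F_1(-a,b;2b;r)^{1/a}\le A_\mu\left(\tfrac12;1,1-r\right)\quad\text{for all } r\in(0,1)$$ if and only if $\lambda\le p_E$ and $\mu\ge p_0$. At the two sharp orders, $$A_{p_E}\left(\tfrac12;1,1-r\right)<{}_2F_1(-a,b;2b;r)^{1/a}<A_{p_0}\left(\tfrac12;1,1-r\right)\quad\text{for all } r\in(0,1).$$
   Context: Weighted power means: for $0<w<1$, $h>0$, $p\in\mathbb{R}$, $A_p(w;1,h)=[w+(1-w)h^p]^{1/p}$ if $p\ne0$ and $A_0(w;1,h)=h^{1-w}$. ${}_2F_1$ is the Gauss hypergeometric function (here ${}_2F_1(-a,b;2b;r)>0$ for $0<r<1$). Parameters: $w=1-\frac bc$ (so $w=\frac12$ when $c=2b$), $p_0=\frac{a+c}{1+c}$, $C_a=\frac{\Gamma(c+a-b)\Gamma(c)}{\Gamma(c-b)\Gamma(c+a)}$, and $p_E=\frac{a\log w}{\log C_a}$. *)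

theory Defs
  imports "HOL-Analysis.Analysis"
begin

(* The arguments are the order p, the weight w and the second mean value h; the first mean value is 1. *)
definition power_mean :: "real \<Rightarrow> real \<Rightarrow> real \<Rightarrow> real" where
  "power_mean p w h =
     (if p = 0 then h powr (1 - w) else (w + (1 - w) * h powr p) powr (1 / p))"

(* The sum of the hypergeometric series, for \<bar>r\<bar> < 1.  The last argument of fps_hypergeo
   is a scaling factor of the variable, here 1. *)
definition hyp2F1 :: "real \<Rightarrow> real \<Rightarrow> real \<Rightarrow> real \<Rightarrow> real" where
  "hyp2F1 \<alpha> \<beta> \<gamma> r = eval_fps (fps_hypergeo [\<alpha>, \<beta>] [\<gamma>] 1) r"

lemma hyp2F1_series:
  "hyp2F1 \<alpha> \<beta> \<gamma> r =
     (\<Sum>n. pochhammer \<alpha> n * pochhammer \<beta> n / (pochhammer \<gamma> n * fact n) * r ^ n)"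
  by (simp add: hyp2F1_def eval_fps_def)

definition weight :: "real \<Rightarrow> real \<Rightarrow> real" where
  "weight b c = 1 - b / c"

definition p_0 :: "real \<Rightarrow> real \<Rightarrow> real" where
  "p_0 a c = (a + c) / (1 + c)"

definition C_a :: "real \<Rightarrow> real \<Rightarrow> real \<Rightarrow> real" where
  "C_a a b c = Gamma (c + a - b) * Gamma c / (Gamma (c - b) * Gamma (c + a))"

definition p_E :: "real \<Rightarrow> real \<Rightarrow> real \<Rightarrow> real" where
  "p_E a b c = a * ln (weight b c) / ln (C_a a b c)"

end

(* Put h = 1 - r, q = h^(p-1), F = 2F1(-a,b;2b;.), A = A_p(1/2;1,h) and V = (ln A)' = -q/(1+hq).
   By Gauss' equation, the Wronskian-type function S = F' - a V F satisfies a first-order linear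
   equation, and after multiplication by the integrating factor r^(2b) (1-r)^(1-a-b) A^a the
   derivative of the resulting Z equals a negative multiple of F times
   b (phi(h) - 1) - (a - p), where phi(h) = (h^(1-p) - h^p)/(1-h).  Since phi strictly decreases
   to 2p - 1 as h increases to 1, Z' changes sign at most once, never if p = 1 or p = p_0.  As Z
   has the sign of (F/A^a)' and Z(0) = 0, the ratio F/A^a increases for p = 1, decreases for
   p = p_0, and exceeds 1 on (0,1) whenever p > 1 and it equals 1 at r = 1; by Gauss' summation
   theorem the latter happens for p = p_E. *)
theory Submission
  imports Defs
begin

section \<open>The hypergeometric series\<close>

text \<open>Telescoping: \<open>g n\<close> is the absolute value of a partial sum of the series
  without absolute values. Once \<open>n\<close> is at least \<open>a\<close>, \<open>g\<close>
  decreases, and the drop from \<open>n\<close> to \<open>Suc n\<close> is exactly the absolute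
  value of term \<open>Suc n\<close>.\<close>

lemma summable_abs_pochhammer_over_fact:
  fixes a :: real
  assumes "a \<ge> 0"
  shows "summable (\<lambda>n. \<bar>pochhammer (- a) n / fact n\<bar>)"
proof -
  define g where "g n = \<bar>pochhammer (1 - a) n / fact n\<bar>" for n
  have eq: "\<bar>pochhammer (- a) (Suc n) / fact (Suc n)\<bar> = g n * (a / (n + 1))" for n
    using assms by (simp add: g_def pochhammer_rec abs_mult abs_divide mult_ac)
  have diff: "g n - g (Suc n) = g n * (a / (n + 1))" if "n \<ge> nat \<lceil>a\<rceil>" for n
  proof -
    have "g (Suc n) = g n * \<bar>(1 - a + n) / (n + 1)\<bar>"
      by (simp add: g_def pochhammer_Suc abs_mult abs_divide)
    also have "\<bar>(1 - a + n) / (n + 1)\<bar> = 1 - a / (n + 1)"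
    proof -
      have "a \<le> n" using that by linarith
      then show ?thesis by (simp add: field_simps)
    qed
    finally show ?thesis by (simp add: algebra_simps)
  qed
  have g_ge0: "g n \<ge> 0" for n by (simp add: g_def)
  define k where "k = nat \<lceil>a\<rceil>"
  have "decseq (\<lambda>n. g (n + k))"
  proof (rule decseq_SucI)
    fix n
    have "g (n + k) * (a / ((n + k) + 1)) \<ge> 0"
      using g_ge0 assms by simp
    then show "g (Suc n + k) \<le> g (n + k)"
      using diff[of "n + k"] by (simp add: k_def)
  qed
  then obtain L where "(\<lambda>n. g (n + k)) \<longlonglongrightarrow> L"
    using decseq_convergent[of "\<lambda>n. g (n + k)" 0] g_ge0 by blast
  then have "summable (\<lambda>n. g (n + k) - g (Suc n + k))"
    using telescope_summable'[of "\<lambda>n. g (n + k)" L] by simp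
  moreover have "g (n + k) - g (Suc n + k) = \<bar>pochhammer (- a) (n + Suc k) / fact (n + Suc k)\<bar>" for n
    using diff[of "n + k"] eq[of "n + k"] by (simp add: k_def)
  ultimately have "summable (\<lambda>n. \<bar>pochhammer (- a) (n + Suc k) / fact (n + Suc k)\<bar>)"
    by (simp only:)
  then show ?thesis
    by (rule summable_iff_shift[THEN iffD1])
qed

lemma sums_one_minus_powr:
  fixes a x :: real
  assumes "\<bar>x\<bar> < 1"
  shows "(\<lambda>n. pochhammer (- a) n / fact n * x ^ n) sums (1 - x) powr a"
proof -
  have "(a gchoose n) * (- x) ^ n = pochhammer (- a) n / fact n * x ^ n" for n
    using power_mult_distrib[of "- 1" "- x" n] by (simp add: gbinomial_pochhammer)
  then show ?thesis
    using gen_binomial_real[of "- x" a] assms by simp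
qed

lemma positive_not_in_nonpos_Ints: "(x::real) > 0 \<Longrightarrow> x \<notin> \<int>\<^sub>\<le>\<^sub>0"
  by (auto elim: nonpos_Ints_cases)

lemma Beta_add_nat:
  fixes b d :: real
  assumes "b > 0" "d > 0"
  shows "Beta (b + real n) d = pochhammer b n / pochhammer (b + d) n * Beta b d"
proof -
  have "pochhammer b n = Gamma (b + n) / Gamma b"
       "pochhammer (b + d) n = Gamma (b + d + n) / Gamma (b + d)"
    using assms by (simp_all add: pochhammer_Gamma positive_not_in_nonpos_Ints)
  moreover have "Gamma b > 0" "Gamma (b + d) > 0"
    using assms by (auto intro: Gamma_real_pos)
  ultimately show ?thesis
    by (simp add: Beta_def add_ac)
qed

text \<open>Integrate the binomial series of \<open>(1 - x) powr a\<close> term by term against the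
  Beta density. Each power of \<open>x\<close> contributes a Beta value, the whole integral is
  \<open>Beta b (c - b + a)\<close>, and \<open>C_a\<close> is its quotient by
  \<open>Beta b (c - b)\<close>.\<close>

lemma Gauss_sums_C_a:
  fixes a b c :: real
  assumes "a \<ge> 0" "0 < b" "b < c"
  shows "(\<lambda>n. pochhammer (- a) n * pochhammer b n / (pochhammer c n * fact n)) sums C_a a b c"
proof -
  define B where "B = Beta b (c - b)"
  define \<beta> where "\<beta> n = pochhammer (- a) n / fact n" for n
  define w where "w x = x powr (b - 1) * (1 - x) powr (c - b - 1)" for x :: real
  have summ: "summable (\<lambda>n. \<bar>\<beta> n\<bar>)"
    using summable_abs_pochhammer_over_fact[OF assms(1)] by (simp add: \<beta>_def)
  define \<epsilon> where "\<epsilon> N = (\<Sum>n. \<bar>\<beta> (n + N)\<bar>)" for N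
  have G: "Gamma b > 0" "Gamma c > 0" "Gamma (c - b) > 0"
    using assms by (simp_all add: Gamma_real_pos)
  then have Bpos: "B > 0" and Ba: "C_a a b c = Beta b (c - b + a) / B"
    by (simp_all add: B_def Beta_def C_a_def algebra_simps)
  have w_int: "(w has_integral B) {0<..<1}"
    using has_integral_Beta_real[of b "c - b"] assms
    by (simp add: has_integral_Icc_iff_Ioo w_def[abs_def] B_def)
  have term_int: "((\<lambda>x. \<beta> n * x ^ n * w x) has_integral \<beta> n * Beta (b + n) (c - b)) {0<..<1}" for n
  proof -
    have "((\<lambda>x. \<beta> n * (x powr (b + n - 1) * (1 - x) powr (c - b - 1))) has_integral \<beta> n * Beta (b + n) (c - b)) {0<..<1}"
      using has_integral_Beta_real[of "b + n" "c - b"] assms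
      by (intro has_integral_mult_right) (simp add: has_integral_Icc_iff_Ioo)
    moreover have "x powr (b + n - 1) = x ^ n * x powr (b - 1)" if "x \<in> {0<..<1}" for x :: real
      using that by (simp add: powr_realpow[symmetric] powr_add[symmetric] add_ac add_diff_eq)
    ultimately show ?thesis
      by (subst has_integral_cong[where g = "\<lambda>x. \<beta> n * (x powr (b + n - 1) * (1 - x) powr (c - b - 1))"])
         (auto simp: w_def)
  qed
  have lim_int: "((\<lambda>x. (1 - x) powr a * w x) has_integral Beta b (c - b + a)) {0<..<1}"
  proof -
    have "((\<lambda>x. x powr (b - 1) * (1 - x) powr (c - b + a - 1)) has_integral Beta b (c - b + a)) {0<..<1}"
      using has_integral_Beta_real[of b "c - b + a"] assms by (simp add: has_integral_Icc_iff_Ioo)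
    moreover have "(1 - x) powr (c - b + a - 1) = (1 - x) powr a * (1 - x) powr (c - b - 1)" for x :: real
      by (simp add: powr_add[symmetric] algebra_simps)
    ultimately show ?thesis
      by (simp add: w_def mult_ac)
  qed
  \<comment> \<open>This replaces a limit theorem for integrals: for \<open>0 < x < 1\<close> the
    remainder of the binomial series is at most the tail of the absolute coefficients, uniformly in
    \<open>x\<close>.\<close>
  have bound: "\<bar>(\<Sum>n<N. \<beta> n * Beta (b + n) (c - b)) - Beta b (c - b + a)\<bar> \<le> \<epsilon> N * B" for N
  proof -
    let ?d = "\<lambda>x. (\<Sum>n<N. \<beta> n * x ^ n * w x) - (1 - x) powr a * w x"
    have d: "(?d has_integral (\<Sum>n<N. \<beta> n * Beta (b + n) (c - b)) - Beta b (c - b + a)) {0<..<1}"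
      by (intro has_integral_diff has_integral_sum term_int lim_int) auto
    have e: "((\<lambda>x. \<epsilon> N * w x) has_integral \<epsilon> N * B) {0<..<1}"
      by (intro has_integral_mult_right w_int)
    have "norm (?d x) \<le> \<epsilon> N * w x" if x: "x \<in> {0<..<1}" for x
    proof -
      have s: "(\<lambda>n. \<beta> n * x ^ n) sums (1 - x) powr a"
        using sums_one_minus_powr[of x a] x by (simp add: \<beta>_def)
      have le: "\<bar>\<beta> (n + N) * x ^ (n + N)\<bar> \<le> \<bar>\<beta> (n + N)\<bar>" for n
        using x by (simp add: abs_mult power_le_one mult_left_le)
      have sN: "summable (\<lambda>n. \<bar>\<beta> (n + N)\<bar>)"
        using summ by (rule summable_ignore_initial_segment)
      have sN': "summable (\<lambda>n. \<bar>\<beta> (n + N) * x ^ (n + N)\<bar>)"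
        by (rule summable_comparison_test'[OF sN]) (use le in simp)
      have "(1 - x) powr a - (\<Sum>n<N. \<beta> n * x ^ n) = (\<Sum>n. \<beta> (n + N) * x ^ (n + N))"
        using suminf_minus_initial_segment[OF sums_summable[OF s], of N] sums_unique[OF s] by simp
      also have "\<bar>\<dots>\<bar> \<le> (\<Sum>n. \<bar>\<beta> (n + N) * x ^ (n + N)\<bar>)"
        by (rule summable_rabs[OF sN'])
      also have "\<dots> \<le> \<epsilon> N"
        unfolding \<epsilon>_def by (rule suminf_le[OF le sN' sN])
      finally have "\<bar>(\<Sum>n<N. \<beta> n * x ^ n) - (1 - x) powr a\<bar> \<le> \<epsilon> N"
        by simp
      moreover have "?d x = ((\<Sum>n<N. \<beta> n * x ^ n) - (1 - x) powr a) * w x"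
        by (simp add: sum_distrib_right left_diff_distrib)
      moreover have "w x \<ge> 0" by (simp add: w_def)
      ultimately show ?thesis
        by (simp add: abs_mult mult_right_mono)
    qed
    then have "norm (integral {0<..<1} ?d) \<le> integral {0<..<1} (\<lambda>x. \<epsilon> N * w x)"
      using d e by (intro integral_norm_bound_integral) (auto simp: has_integral_iff)
    then show ?thesis
      unfolding integral_unique[OF d] integral_unique[OF e] by simp
  qed
  have "\<epsilon> \<longlonglongrightarrow> 0"
    unfolding \<epsilon>_def using suminf_exist_split2[OF summ] by (simp add: add.commute)
  then have "(\<lambda>N. \<epsilon> N * B) \<longlonglongrightarrow> 0"
    by (rule tendsto_mult_left_zero)
  then have "(\<lambda>N. (\<Sum>n<N. \<beta> n * Beta (b + n) (c - b)) - Beta b (c - b + a)) \<longlonglongrightarrow> 0"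
    by (rule Lim_null_comparison[rotated]) (use bound in simp)
  then have "(\<lambda>n. \<beta> n * Beta (b + n) (c - b)) sums Beta b (c - b + a)"
    unfolding sums_def by (rule LIM_zero_cancel)
  then have "(\<lambda>n. \<beta> n * Beta (b + n) (c - b) / B) sums C_a a b c"
    unfolding Ba by (rule sums_divide)
  moreover have "\<beta> n * Beta (b + n) (c - b) / B
                  = pochhammer (- a) n * pochhammer b n / (pochhammer c n * fact n)" for n
    using assms Bpos by (simp add: Beta_add_nat[of b "c - b" n] B_def[symmetric] \<beta>_def)
  ultimately show ?thesis by (simp only:)
qed

text \<open>The definition sums the series wherever it converges, so it also gives the value at 1,
  possibly on the boundary of the disc of convergence.\<close>

lemma hyp2F1_at_1:
  assumes "a \<ge> 0" "0 < b" "b < c"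
  shows "hyp2F1 (- a) b c 1 = C_a a b c"
  using sums_unique[OF Gauss_sums_C_a[OF assms]] by (simp only: hyp2F1_series power_one mult_1_right)

lemma abs_hyp2F1_coeff_le:
  fixes a b c :: real
  assumes "0 < b" "b \<le> c"
  shows "\<bar>pochhammer (- a) n * pochhammer b n / (pochhammer c n * fact n)\<bar> \<le> \<bar>pochhammer (- a) n / fact n\<bar>"
proof -
  have "pochhammer b n \<le> pochhammer c n"
    unfolding pochhammer_prod using assms by (intro prod_mono) auto
  moreover have "pochhammer b n > 0" "pochhammer c n > 0"
    using assms by (auto intro: pochhammer_pos)
  ultimately have "\<bar>pochhammer (- a) n / fact n\<bar> * (pochhammer b n / pochhammer c n)
                     \<le> \<bar>pochhammer (- a) n / fact n\<bar>"
    by (intro mult_left_le) auto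
  then show ?thesis
    using \<open>pochhammer b n > 0\<close> \<open>pochhammer c n > 0\<close> by (simp add: abs_mult abs_divide mult_ac)
qed

section \<open>Continuity up to 1 and radius of convergence\<close>

text \<open>Weierstrass' M-test with the binomial coefficients as majorant. Including the endpoint 1
  is the point: the limit there determines \<open>p_E\<close>.\<close>

lemma continuous_on_hyp2F1:
  assumes "a \<ge> 0" "0 < b" "b \<le> c"
  shows "continuous_on {0..1} (hyp2F1 (- a) b c)"
proof -
  let ?f = "\<lambda>n r. pochhammer (- a) n * pochhammer b n / (pochhammer c n * fact n) * r ^ n"
  have "uniform_limit {0..1} (\<lambda>N r. \<Sum>n<N. ?f n r) (\<lambda>r. \<Sum>n. ?f n r) sequentially"
  proof (rule Weierstrass_m_test)
    fix n :: nat and r :: real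
    assume "r \<in> {0..1}"
    then have "\<bar>r ^ n\<bar> \<le> 1"
      by (simp add: power_le_one)
    then show "norm (?f n r) \<le> \<bar>pochhammer (- a) n / fact n\<bar>"
      using mult_mono[OF abs_hyp2F1_coeff_le[of b c a n, OF assms(2,3)], of "\<bar>r ^ n\<bar>" 1]
      by (simp only: real_norm_def abs_mult[of _ "r ^ n"]) simp
  qed (rule summable_abs_pochhammer_over_fact[OF assms(1)])
  then show ?thesis
    unfolding hyp2F1_series
    by (rule uniform_limit_theorem[rotated])
       (auto simp only: divide_inverse trivial_limit_sequentially intro!: always_eventually continuous_intros)
qed

lemma fps_conv_radius_hypergeo_ge_1:
  fixes a b c :: real
  assumes "a \<ge> 0" "0 < b" "b \<le> c"
  shows "fps_conv_radius (fps_hypergeo [- a, b] [c] 1) \<ge> 1"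
proof -
  have "summable (\<lambda>n. pochhammer (- a) n * pochhammer b n / (pochhammer c n * fact n))"
    by (rule summable_comparison_test'[OF summable_abs_pochhammer_over_fact[OF assms(1)], of 0])
       (use abs_hyp2F1_coeff_le[of b c a] assms in \<open>simp only: real_norm_def\<close>)
  then have "conv_radius (fps_nth (fps_hypergeo [- a, b] [c] 1)) \<ge> ereal (norm (1 :: real))"
    by (intro conv_radius_geI) simp
  then show ?thesis
    by (simp add: fps_conv_radius_def one_ereal_def)
qed

section \<open>Gauss' differential equation\<close>

unbundle no vec_syntax
unbundle fps_syntax

text \<open>At each power of \<open>fps_X\<close> the equation is the two-term recurrence
  \<open>rec\<close> of the coefficients, because n(n-1) + (alpha+beta+1)n + alpha beta factors as
  (n+alpha)(n+beta).\<close>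

lemma fps_hypergeo_ode:
  fixes \<alpha> \<beta> \<gamma> :: "'a :: field_char_0"
  assumes "\<And>n. \<gamma> + of_nat n \<noteq> 0"
  defines "H \<equiv> fps_hypergeo [\<alpha>, \<beta>] [\<gamma>] 1"
  shows "fps_X * fps_deriv (fps_deriv H) + fps_const \<gamma> * fps_deriv H =
         fps_X * (fps_X * fps_deriv (fps_deriv H)) + fps_const (\<alpha> + \<beta> + 1) * (fps_X * fps_deriv H) + fps_const (\<alpha> * \<beta>) * H"
proof (rule fps_ext)
  fix n
  have rec: "of_nat (Suc n) * (\<gamma> + of_nat n) * (H $ Suc n) = (\<alpha> + of_nat n) * (\<beta> + of_nat n) * (H $ n)"
  proof -
    have "H $ Suc n = (\<alpha> + of_nat n) * (\<beta> + of_nat n) / (of_nat (Suc n) * (\<gamma> + of_nat n)) * (H $ n)"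
      unfolding H_def by (subst fps_hypergeo_rec) (simp del: of_nat_Suc fps_hypergeo_nth)
    moreover have "of_nat (Suc n) * (\<gamma> + of_nat n) \<noteq> 0"
      using assms(1)[of n] by (simp del: of_nat_Suc)
    ultimately show ?thesis by (simp del: of_nat_Suc)
  qed
  \<comment> \<open>The case splits treat the lowest indices, where the shifted coefficient is 0 and
    so is the factor in \<open>n\<close>.\<close>
  have X1: "(fps_X * fps_deriv H) $ n = of_nat n * H $ n"
    by (cases n) simp_all
  have X2: "(fps_X * fps_deriv (fps_deriv H)) $ n = of_nat n * of_nat (Suc n) * H $ Suc n"
    by (cases n) (simp_all add: mult_ac)
  have X3: "(fps_X * (fps_X * fps_deriv (fps_deriv H))) $ n = of_nat n * (of_nat n - 1) * H $ n"
  proof (cases n)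
    case (Suc m)
    then show ?thesis by (cases m) (simp_all add: mult_ac)
  qed simp
  show "(fps_X * fps_deriv (fps_deriv H) + fps_const \<gamma> * fps_deriv H) $ n =
         (fps_X * (fps_X * fps_deriv (fps_deriv H)) + fps_const (\<alpha> + \<beta> + 1) * (fps_X * fps_deriv H) + fps_const (\<alpha> * \<beta>) * H) $ n"
    unfolding fps_add_nth fps_mult_left_const_nth X1 X2 X3 fps_deriv_nth
    using rec by (simp add: algebra_simps)
qed

text \<open>Inside the unit disc, evaluation commutes with the ring operations and with
  differentiation, so the formal equation carries over.\<close>

lemma hyp2F1_ode:
  fixes a b c :: real
  assumes "a \<ge> 0" "0 < b" "b \<le> c"
  obtains F' F'' where
    "\<And>r. \<bar>r\<bar> < 1 \<Longrightarrow> (hyp2F1 (- a) b c has_real_derivative F' r) (at r)"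
    "\<And>r. \<bar>r\<bar> < 1 \<Longrightarrow> (F' has_real_derivative F'' r) (at r)"
    "\<And>r. \<bar>r\<bar> < 1 \<Longrightarrow> r * (1 - r) * F'' r + (c - (1 - a + b) * r) * F' r + a * b * hyp2F1 (- a) b c r = 0"
proof
  define H where "H = fps_hypergeo [- a, b] [c] 1"
  define F' where "F' = eval_fps (fps_deriv H)"
  define F'' where "F'' = eval_fps (fps_deriv (fps_deriv H))"
  fix r :: real
  assume r: "\<bar>r\<bar> < 1"
  have "ereal (norm r) < 1" using r by (simp add: one_ereal_def)
  then have R0: "ereal (norm r) < fps_conv_radius H"
    using fps_conv_radius_hypergeo_ge_1[OF assms] unfolding H_def by (rule less_le_trans)
  then have R1: "ereal (norm r) < fps_conv_radius (fps_deriv H)"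
    using fps_conv_radius_deriv[of H] by (rule less_le_trans)
  then have R2: "ereal (norm r) < fps_conv_radius (fps_deriv (fps_deriv H))"
    using fps_conv_radius_deriv[of "fps_deriv H"] by (rule less_le_trans)
  show "(hyp2F1 (- a) b c has_real_derivative F' r) (at r)"
    unfolding F'_def hyp2F1_def[abs_def] H_def[symmetric] using R0 by (rule has_field_derivative_eval_fps)
  show "(F' has_real_derivative F'' r) (at r)"
    unfolding F'_def F''_def using R1 by (rule has_field_derivative_eval_fps)
  have less_add: "ereal (norm r) < fps_conv_radius (f + g)"
    if "ereal (norm r) < fps_conv_radius f" "ereal (norm r) < fps_conv_radius g" for f g :: "real fps"
    using fps_conv_radius_add[of f g] that by (meson less_le_trans min_less_iff_conj)
  have less_mult: "ereal (norm r) < fps_conv_radius (f * g)"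
    if "ereal (norm r) < fps_conv_radius f" "ereal (norm r) < fps_conv_radius g" for f g :: "real fps"
    using fps_conv_radius_mult[of f g] that by (meson less_le_trans min_less_iff_conj)
  have radius_inf: "ereal (norm r) < fps_conv_radius fps_X" "ereal (norm r) < fps_conv_radius (fps_const x)" for x
    by simp_all
  have "c + real n \<noteq> 0" for n using assms by (simp add: add_pos_nonneg less_imp_neq[THEN not_sym])
  then have "eval_fps (fps_X * fps_deriv (fps_deriv H) + fps_const c * fps_deriv H) r =
        eval_fps (fps_X * (fps_X * fps_deriv (fps_deriv H)) + fps_const (- a + b + 1) * (fps_X * fps_deriv H)
                   + fps_const (- a * b) * H) r"
    unfolding H_def by (intro arg_cong[where f = "\<lambda>f. eval_fps f r"] fps_hypergeo_ode)
  then have "r * F'' r + c * F' r = r * (r * F'' r) + (- a + b + 1) * (r * F' r) + (- a * b) * hyp2F1 (- a) b c r"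
    unfolding F'_def F''_def hyp2F1_def H_def[symmetric]
    by (simp only: eval_fps_add eval_fps_mult less_add less_mult R0 R1 R2 radius_inf eval_fps_const eval_fps_X)
  then show "r * (1 - r) * F'' r + (c - (1 - a + b) * r) * F' r + a * b * hyp2F1 (- a) b c r = 0"
    by (simp add: algebra_simps)
qed

section \<open>Monotonicity of power means in the order\<close>

lemma half_power_mean_eq: "p \<noteq> 0 \<Longrightarrow> h \<ge> 0 \<Longrightarrow> power_mean p (1/2) h = ((1 + h powr p) / 2) powr (1 / p)"
  by (simp add: power_mean_def add_divide_distrib)

text \<open>The inequality of arithmetic and geometric means for 1 and
  \<open>h powr p\<close>.\<close>

lemma geometric_le_half_power_mean:
  assumes "p > 0" "h > 0"
  shows "power_mean 0 (1/2) h \<le> power_mean p (1/2) h"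
proof -
  have "h powr (p / 2) \<le> (1 + h powr p) / 2"
    using arith_geo_mean_sqrt[of 1 "h powr p"] assms by (simp add: powr_half_sqrt_powr[symmetric])
  then have "(h powr (p / 2)) powr (1 / p) \<le> ((1 + h powr p) / 2) powr (1 / p)"
    using assms by (intro powr_mono2) auto
  then show ?thesis
    using assms by (simp add: half_power_mean_eq powr_powr) (simp add: power_mean_def)
qed

text \<open>Factor out \<open>h powr - p\<close>. This reflection reduces negative orders to
  positive ones.\<close>

lemma half_power_mean_uminus:
  assumes "h > 0"
  shows "power_mean (- p) (1/2) h = h / power_mean p (1/2) h"
proof (cases "p = 0")
  case True
  have "h powr (1/2) * h powr (1/2) = h"
    using assms by (simp add: powr_add[symmetric])
  then show ?thesis using True assms by (simp add: power_mean_def field_simps)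
next
  case False
  have "1 + h powr p > 0" by (simp add: add_pos_nonneg)
  have "(1 + h powr - p) / 2 = ((1 + h powr p) / 2) / h powr p"
    using assms by (simp add: powr_minus field_simps)
  then have "((1 + h powr - p) / 2) powr (1 / - p) = ((1 + h powr p) / 2) powr (- (1 / p)) / (h powr p) powr (- (1 / p))"
    by (simp only: powr_divide minus_divide_right)
  also have "\<dots> = h / ((1 + h powr p) / 2) powr (1 / p)"
    using assms False by (simp add: powr_powr powr_minus field_simps)
  finally show ?thesis using False assms by (simp add: half_power_mean_eq)
qed

text \<open>Midpoint convexity of the power \<open>q / p\<close> at the points 1 and
  \<open>h powr p\<close>.\<close>

lemma half_power_mean_mono_pos:
  assumes "0 < p" "p \<le> q" "h > 0"
  shows "power_mean p (1/2) h \<le> power_mean q (1/2) h"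
proof -
  have "convex_on {0<..} (\<lambda>x. x powr (q / p))"
    using assms by (intro powr_convex) auto
  from convex_onD[OF this, of "1/2" 1 "h powr p"]
  have "((1 + h powr p) / 2) powr (q / p) \<le> (1 + h powr q) / 2"
    using assms by (simp add: powr_powr add_divide_distrib)
  then have "(((1 + h powr p) / 2) powr (q / p)) powr (1 / q) \<le> ((1 + h powr q) / 2) powr (1 / q)"
    using assms by (intro powr_mono2) auto
  then show ?thesis
    using assms by (simp add: half_power_mean_eq powr_powr)
qed

text \<open>Order 0 links the two signs: orders of opposite sign are compared through the geometric
  mean, two negative orders by reflection.\<close>

lemma half_power_mean_mono:
  assumes "p \<le> q" "h > 0"
  shows "power_mean p (1/2) h \<le> power_mean q (1/2) h"
proof -
  have pos: "power_mean s (1/2) h > 0" for s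
    using assms by (simp add: power_mean_def add_pos_nonneg less_imp_neq[THEN not_sym])
  have neg: "power_mean s (1/2) h \<le> power_mean t (1/2) h"
    if "power_mean (- t) (1/2) h \<le> power_mean (- s) (1/2) h" for s t
    using that pos[of "- t"] pos[of "- s"] assms half_power_mean_uminus[of h "- s"] half_power_mean_uminus[of h "- t"]
    by (simp add: frac_le)
  consider "0 < p" | "p \<le> 0" "q \<ge> 0" | "q < 0" by linarith
  then show ?thesis
  proof cases
    case 1
    then show ?thesis using assms by (intro half_power_mean_mono_pos)
  next
    case 2
    have "power_mean p (1/2) h \<le> power_mean 0 (1/2) h"
      using geometric_le_half_power_mean[of "- p" h] assms 2 by (cases "p = 0") (auto intro: neg)
    also have "\<dots> \<le> power_mean q (1/2) h"
      using geometric_le_half_power_mean[of q h] assms 2 by (cases "q = 0") auto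
    finally show ?thesis .
  next
    case 3
    show ?thesis by (rule neg, rule half_power_mean_mono_pos) (use assms 3 in auto)
  qed
qed

section \<open>The ratio of the two means\<close>

definition chord_slope :: "real \<Rightarrow> real \<Rightarrow> real" where
  "chord_slope p h = (h powr (1 - p) - h powr p) / (1 - h)"

text \<open>At order 1 the sign criterion reads \<open>0 < a - 1\<close>. This case yields the
  positivity of the hypergeometric function and \<open>1 < p_E\<close>.\<close>

lemma chord_slope_1: "0 < h \<Longrightarrow> h < 1 \<Longrightarrow> chord_slope 1 h = 1"
  by (simp add: chord_slope_def)

text \<open>Up to sign, this is the slope of the chord from \<open>h\<close> to \<open>1\<close> of
  \<open>\<psi> h = h powr (1 - p) - h powr p\<close>, which is strictly convex on \<open>(0, 1)\<close>.\<close>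
lemma chord_slope_strict_decreasing:
  assumes "p > 1" "0 < x" "x < y" "y < 1"
  shows "chord_slope p y < chord_slope p x"
proof (rule DERIV_neg_imp_decreasing[where f = "chord_slope p" and a = x and b = y])
  fix h assume "x \<le> h" "h \<le> y"
  then have h: "0 < h" "h < 1" using assms by auto
  let ?\<psi> = "\<lambda>h. h powr (1 - p) - h powr p"
  let ?\<psi>' = "\<lambda>h. (1 - p) * h powr (- p) - p * h powr (p - 1)"
  \<comment> \<open>This is \<open>(1 - h)\<^sup>2\<close> times the derivative of the chord slope.
    It vanishes at 1, and its own derivative is \<open>1 - h\<close> times the second derivative of
    \<open>?\<psi>\<close>, so it is negative before 1.\<close>
  let ?g = "\<lambda>h. ?\<psi>' h * (1 - h) + ?\<psi> h"
  have "?g h < ?g 1"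
  proof (rule DERIV_pos_imp_increasing_open[where f = ?g and a = h and b = 1])
    fix t assume t: "h < t" "t < 1"
    have d: "(?g has_real_derivative p * (p - 1) * (t powr (- p - 1) - t powr (p - 2)) * (1 - t)) (at t)"
      using t h by (auto intro!: derivative_eq_intros simp: algebra_simps)
    have "t powr (p - 2) < t powr (- p - 1)"
      using t h assms by (intro powr_less_mono') auto
    then have "p * (p - 1) * (t powr (- p - 1) - t powr (p - 2)) * (1 - t) > 0"
      using t assms by simp
    with d show "\<exists>y. (?g has_real_derivative y) (at t) \<and> y > 0" by blast
  qed (use h in \<open>auto intro!: continuous_intros\<close>)
  then have neg: "?g h < 0" by simp
  have "(chord_slope p has_real_derivative ?g h / (1 - h)\<^sup>2) (at h)"
    unfolding chord_slope_def[abs_def] using h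
    by (auto intro!: derivative_eq_intros simp: power2_eq_square)
  moreover have "?g h / (1 - h)\<^sup>2 < 0"
    using neg h by (simp add: divide_neg_pos)
  ultimately show "\<exists>d. (chord_slope p has_real_derivative d) (at h) \<and> d < 0" by blast
qed (use assms in auto)

text \<open>The numerator vanishes at \<open>h = 1\<close>, so the limit is minus its derivative
  there.\<close>

lemma tendsto_chord_slope: "(chord_slope p \<longlongrightarrow> 2 * p - 1) (at_left 1)"
proof -
  have "((\<lambda>h. h powr (1 - p) - h powr p) has_real_derivative 1 - 2 * p) (at 1)"
    by (auto intro!: derivative_eq_intros)
  then have "((\<lambda>h. (h powr (1 - p) - h powr p) / (h - 1)) \<longlongrightarrow> 1 - 2 * p) (at 1)"
    by (simp add: has_field_derivative_iff)
  then have "((\<lambda>h. - ((h powr (1 - p) - h powr p) / (h - 1))) \<longlongrightarrow> - (1 - 2 * p)) (at_left 1)"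
    by (intro tendsto_minus) (rule tendsto_within_subset, auto)
  moreover have "- ((h powr (1 - p) - h powr p) / (h - 1)) = chord_slope p h" for h
    by (simp add: chord_slope_def minus_divide_right)
  ultimately show ?thesis by simp
qed

lemma chord_slope_gt:
  assumes "p > 1" "0 < h" "h < 1"
  shows "chord_slope p h > 2 * p - 1"
proof -
  \<comment> \<open>A point strictly between \<open>h\<close> and 1: passing to the limit gives only
    a weak inequality at \<open>m\<close>, and strictness comes from the step from \<open>m\<close>
    back to \<open>h\<close>.\<close>
  define m where "m = (h + 1) / 2"
  have m: "h < m" "m < 1" using assms by (auto simp: m_def)
  have "2 * p - 1 \<le> chord_slope p m"
  proof (rule tendsto_le[OF trivial_limit_at_left_real tendsto_const tendsto_chord_slope])
    show "\<forall>\<^sub>F x in at_left 1. chord_slope p x \<le> chord_slope p m"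
      using eventually_at_left_real[OF m(2)]
    proof eventually_elim
      case (elim x)
      then show ?case using chord_slope_strict_decreasing[of p m x] assms m by simp
    qed
  qed
  also have "\<dots> < chord_slope p h"
    using chord_slope_strict_decreasing[of p h m] assms m by simp
  finally show ?thesis .
qed

text \<open>Here \<open>h = 1 - r\<close>, and \<open>D\<close>, \<open>V\<close>, \<open>V'\<close> are the values of \<open>1 + h powr p\<close>, of the
  logarithmic derivative of the power mean with respect to \<open>r\<close>, and of the derivative of the latter.\<close>
lemma wronskian_identity:
  fixes a b p h q D V V' e :: real
  assumes h: "0 < h" "h < 1" and D: "D = 1 + h * q" "D > 0"
    and V: "V = - q / D" "V' = q * (p - 1 - h * q) / (h * D\<^sup>2)"
    and ode: "(1 - h) * h * F2 + (2 * b - (1 - a + b) * (1 - h)) * F1 + a * b * F = 0"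
    and e: "q * (1 - h) * e = b * (1 - q) * D - (a - p) * q * (1 - h)"
  shows "(2 * b / (1 - h) + (a + b - 1) / h + a * V) * (F1 - a * V * F) + (F2 - a * V' * F - a * V * F1)
          = - e * (a * q / (h * D\<^sup>2)) * F" (is "?L = _")
proof -
  let ?\<kappa> = "2 * b - (1 - a + b) * (1 - h)"
  \<comment> \<open>Up to the factor \<open>a\<close>, this is what Gauss' operator, applied to the
    \<open>a\<close>-th power of the mean, leaves after division by that power.\<close>
  let ?E = "h * (1 - h) * (V' + a * V\<^sup>2) + ?\<kappa> * V + b"
  have "h * (1 - h) * (2 * b / (1 - h) + (a + b - 1) / h) = ?\<kappa>"
    using h by (simp add: field_simps)
  then have "h * (1 - h) * ?L = (?\<kappa> + h * (1 - h) * (a * V)) * (F1 - a * V * F)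
              + h * (1 - h) * (F2 - a * V' * F - a * V * F1)"
    by (simp add: distrib_left mult.assoc[symmetric])
  \<comment> \<open>The equation replaces the terms with \<open>F2\<close> and
    \<open>?\<kappa> * F1\<close> by a multiple of \<open>F\<close>; the other terms with
    \<open>F1\<close> cancel.\<close>
  also have "\<dots> = - a * F * ?E"
    using ode by algebra
  finally have L: "h * (1 - h) * ?L = - a * F * ?E" .
  have DV: "D * V = - q" and DV': "h * D\<^sup>2 * V' = q * (p - 1 - h * q)"
    using V D(2) h by (auto simp: field_simps)
  have "D\<^sup>2 * ?E = (1 - h) * (h * D\<^sup>2 * V') + h * (1 - h) * a * (D * V)\<^sup>2 + ?\<kappa> * (D * V) * D + b * D\<^sup>2"
    by algebra
  also have "\<dots> = q * (1 - h) * e"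
    unfolding DV DV' e unfolding D(1) by algebra
  finally have "D\<^sup>2 * (h * (1 - h) * ?L) = - a * F * (q * (1 - h) * e)"
    unfolding L by (metis mult.left_commute)
  then have "(1 - h) * (h * D\<^sup>2 * ?L) = (1 - h) * (- e * (a * q) * F)"
    by algebra
  then have "h * D\<^sup>2 * ?L = - e * (a * q) * F"
    by (subst (asm) mult_cancel_left) (use h in simp)
  then show ?thesis
    using h D(2) by (simp add: field_simps)
qed

section \<open>The ratio of the \<open>a\<close>-th powers and its Wronskian-type function\<close>

text \<open>Comparing \<open>a\<close>-th powers avoids the root of the hypergeometric function,
  whose positivity is itself deduced from this ratio.\<close>

definition mean_ratio :: "real \<Rightarrow> real \<Rightarrow> real \<Rightarrow> real \<Rightarrow> real" where
  "mean_ratio a b p r = hyp2F1 (- a) b (2 * b) r / ((1 + (1 - r) powr p) / 2) powr (a / p)"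

lemma continuous_on_mean_ratio:
  assumes "a > 1" "b > 0" "p \<ge> 1"
  shows "continuous_on {0..1} (mean_ratio a b p)"
proof -
  have "1 + (1 - r) powr p > 0" for r :: real
    by (simp add: add_pos_nonneg)
  then show ?thesis
    unfolding mean_ratio_def[abs_def]
    by (intro continuous_intros continuous_on_hyp2F1 continuous_on_powr')
       (use assms in \<open>auto simp: less_imp_neq[THEN not_sym]\<close>)
qed

lemma mean_ratio_0: "mean_ratio a b p 0 = 1"
  by (simp add: mean_ratio_def hyp2F1_def eval_fps_at_0 del: fps_hypergeo_nth)

text \<open>Since \<open>0 powr p = 0\<close>, the mean at \<open>r = 1\<close> depends on the order
  only through a power of 2. The order that makes this value 1 is \<open>p_E\<close>.\<close>

lemma mean_ratio_1:
  assumes "a > 1" "b > 0" "p \<ge> 1"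
  shows "mean_ratio a b p 1 = C_a a b (2 * b) * 2 powr (a / p)"
  using assms hyp2F1_at_1[of a b "2 * b"] by (simp add: mean_ratio_def powr_divide)

text \<open>Only signs of derivatives matter later, so the positive factors \<open>k\<close> are
  left existential.\<close>

lemma mean_ratio_wronskian:
  assumes "a > 1" "b > 0" "p \<ge> 1"
  obtains Z where "continuous_on {0..<1} Z" "Z 0 = 0"
    "\<And>r. 0 < r \<Longrightarrow> r < 1 \<Longrightarrow> \<exists>k>0. (mean_ratio a b p has_real_derivative k * Z r) (at r)"
    "\<And>r. 0 < r \<Longrightarrow> r < 1 \<Longrightarrow> \<exists>k>0. (Z has_real_derivative
       - (b * (chord_slope p (1 - r) - 1) - (a - p)) * k * hyp2F1 (- a) b (2 * b) r) (at r)"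
proof -
  let ?F = "hyp2F1 (- a) b (2 * b)"
  obtain F' F'' where
    F': "\<And>r. \<bar>r\<bar> < 1 \<Longrightarrow> (?F has_real_derivative F' r) (at r)" and
    F'': "\<And>r. \<bar>r\<bar> < 1 \<Longrightarrow> (F' has_real_derivative F'' r) (at r)" and
    ode: "\<And>r. \<bar>r\<bar> < 1 \<Longrightarrow> r * (1 - r) * F'' r + (2 * b - (1 - a + b) * r) * F' r + a * b * ?F r = 0"
    using hyp2F1_ode[of a b "2 * b"] assms by auto
  define q where "q r = (1 - r) powr (p - 1)" for r
  define D where "D r = 1 + (1 - r) * q r" for r
  define V where "V r = - q r / D r" for r
  define V' where "V' r = q r * (p - 1 - (1 - r) * q r) / ((1 - r) * (D r)\<^sup>2)" for r
  define M where "M r = (D r / 2) powr (a / p)" for r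
  \<comment> \<open>\<open>r * (1 - r)\<close> times the logarithmic derivative of \<open>W\<close>
    is the coefficient of \<open>F'\<close> in Gauss' equation. As \<open>b > 0\<close>,
    \<open>W\<close> vanishes at 0, hence so does \<open>Z\<close>.\<close>
  define W where "W r = r powr (2 * b) * (1 - r) powr (- (a + b - 1))" for r
  define S where "S r = F' r - a * V r * ?F r" for r
  define Z where "Z r = W r * M r * S r" for r
  have D_alt: "D r = 1 + (1 - r) powr p" if "r < 1" for r
    using that powr_add[of "1 - r" 1 "p - 1"] by (simp add: D_def q_def)
  have Dpos: "D r > 0" if "r < 1" for r
    using that by (simp add: D_alt add_pos_nonneg)
  have Mpos: "M r > 0" if "r < 1" for r
    using Dpos[OF that] by (simp add: M_def)
  have ratio: "mean_ratio a b p r = ?F r / M r" if "r < 1" for r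
    using that by (simp add: mean_ratio_def M_def D_alt)
  have q_deriv: "(q has_real_derivative - (p - 1) * (q r / (1 - r))) (at r)" if "r < 1" for r
    unfolding q_def[abs_def]
    by (rule DERIV_cong, rule DERIV_fun_powr[where m = "- 1"])
       (use that in \<open>auto intro!: derivative_eq_intros simp: powr_diff power2_eq_square minus_divide_left algebra_simps\<close>)
  have D_deriv: "(D has_real_derivative - p * q r) (at r)" if "r < 1" for r
  proof -
    have "(D has_real_derivative (1 - r) * (- (p - 1) * (q r / (1 - r))) - q r) (at r)"
      unfolding D_def[abs_def] using that
      by (auto intro!: derivative_eq_intros q_deriv)
    moreover have "(1 - r) * (- (p - 1) * (q r / (1 - r))) = - (p - 1) * q r"
      using that by simp
    ultimately have "(D has_real_derivative - (p - 1) * q r - q r) (at r)"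
      by (simp only:)
    then show ?thesis by (simp add: algebra_simps)
  qed
  have V_deriv: "(V has_real_derivative V' r) (at r)" if "r < 1" for r
  proof -
    have "D r \<noteq> 0" using Dpos[OF that] by simp
    then have "(V has_real_derivative (- (- (p - 1) * (q r / (1 - r))) * D r - - q r * (- p * q r)) / (D r * D r)) (at r)"
      unfolding V_def[abs_def] by (intro DERIV_divide DERIV_minus q_deriv D_deriv that)
    moreover have "- (- (p - 1) * (q r / (1 - r))) * D r - - q r * (- p * q r) = q r * (p - 1 - (1 - r) * q r) / (1 - r)"
    proof -
      have "(1 - r) * (- (- (p - 1) * (q r / (1 - r))) * D r - - q r * (- p * q r))
              = (p - 1) * (q r * D r) - (1 - r) * (q r * (p * q r))"
        using that by (simp add: right_diff_distrib) (simp add: algebra_simps)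
      also have "\<dots> = q r * (p - 1 - (1 - r) * q r)"
        unfolding D_def by (simp add: algebra_simps)
      finally show ?thesis using that by (subst eq_divide_eq) (simp add: mult.commute)
    qed
    ultimately show ?thesis by (simp add: V'_def power2_eq_square)
  qed
  have M_deriv: "(M has_real_derivative a * V r * M r) (at r)" if "r < 1" for r
  proof -
    have "D r > 0" using Dpos[OF that] .
    then have "(M has_real_derivative a / p * (D r / 2) powr (a / p - of_nat 1) * (- p * q r / 2)) (at r)"
      unfolding M_def[abs_def] by (intro DERIV_fun_powr DERIV_cdivide D_deriv that) simp
    moreover have "a / p * (D r / 2) powr (a / p - of_nat 1) * (- p * q r / 2) = a * V r * M r"
      unfolding powr_diff using \<open>D r > 0\<close> assms by (simp add: M_def V_def field_simps)
    ultimately show ?thesis by simp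
  qed
  have W_deriv: "(W has_real_derivative W r * (2 * b / r + (a + b - 1) / (1 - r))) (at r)" if "0 < r" "r < 1" for r
  proof -
    have "((\<lambda>r. r powr (2 * b)) has_real_derivative r powr (2 * b) * (2 * b / r)) (at r)"
      using has_real_derivative_powr[of r "2 * b"] that by (simp add: powr_diff mult_ac)
    moreover have "((\<lambda>r. (1 - r) powr s) has_real_derivative (1 - r) powr s * (- s / (1 - r))) (at r)" for s
      by (rule DERIV_cong[OF DERIV_fun_powr[where m = "- 1"]])
         (use that in \<open>auto intro!: derivative_eq_intros simp: powr_diff\<close>)
    from this[of "- (a + b - 1)"] have "((\<lambda>r. (1 - r) powr (- (a + b - 1))) has_real_derivative
                     (1 - r) powr (- (a + b - 1)) * ((a + b - 1) / (1 - r))) (at r)"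
      by (simp only: minus_minus)
    ultimately show ?thesis
      unfolding W_def[abs_def] by (rule DERIV_cong[OF DERIV_mult]) (simp add: algebra_simps)
  qed
  have S_deriv: "(S has_real_derivative F'' r - a * V' r * ?F r - a * V r * F' r) (at r)" if "0 \<le> r" "r < 1" for r
    unfolding S_def[abs_def]
    by (rule DERIV_cong[OF DERIV_diff[OF F'' DERIV_mult[OF DERIV_cmult[OF V_deriv] F']]])
       (use that in \<open>auto simp: algebra_simps\<close>)
  show ?thesis
  proof
    have "continuous_on {0..<1} W"
      unfolding W_def[abs_def] using assms by (intro continuous_intros continuous_on_powr') auto
    moreover have "continuous_on {0..<1} M"
      by (rule DERIV_continuous_on, rule has_field_derivative_at_within, rule M_deriv) simp
    moreover have "continuous_on {0..<1} S"
      by (rule DERIV_continuous_on, rule has_field_derivative_at_within, rule S_deriv) simp_all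
    ultimately show "continuous_on {0..<1} Z"
      unfolding Z_def[abs_def] by (intro continuous_intros)
    show "Z 0 = 0" by (simp add: Z_def W_def)
  next
    fix r :: real assume r: "0 < r" "r < 1"
    have Wpos: "W r > 0" using r by (simp add: W_def)
    have "((\<lambda>r. ?F r / M r) has_real_derivative S r / M r) (at r)"
      by (rule DERIV_cong[OF DERIV_divide[OF F' M_deriv]])
         (use Mpos[OF r(2)] r in \<open>auto simp: S_def field_simps\<close>)
    then have "((\<lambda>r. ?F r / M r) has_real_derivative 1 / (W r * (M r)\<^sup>2) * Z r) (at r)"
      using Mpos[OF r(2)] Wpos by (simp add: Z_def power2_eq_square)
    moreover have "eventually (\<lambda>x. x \<in> {..<1}) (nhds r)"
      using r by (intro eventually_nhds_in_open) auto
    then have "eventually (\<lambda>x. mean_ratio a b p x = ?F x / M x) (nhds r)"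
      by eventually_elim (auto simp: ratio)
    ultimately have "(mean_ratio a b p has_real_derivative 1 / (W r * (M r)\<^sup>2) * Z r) (at r)"
      by (subst DERIV_cong_ev) auto
    moreover have "1 / (W r * (M r)\<^sup>2) > 0" using Wpos Mpos[OF r(2)] by simp
    ultimately show "\<exists>k>0. (mean_ratio a b p has_real_derivative k * Z r) (at r)" by blast
    have qpos: "q r > 0" using r by (simp add: q_def)
    let ?e = "b * (chord_slope p (1 - r) - 1) - (a - p)"
    \<comment> \<open>With \<open>h = 1 - r\<close>, the two powers in the chord slope are
      \<open>1 / q r\<close> and \<open>h * q r\<close>; multiplying out,
      \<open>q r * r * (chord_slope p h - 1)\<close> factors as
      \<open>(1 - q r) * D r\<close>.\<close>
    have slope: "chord_slope p (1 - r) = (1 / q r - (1 - r) * q r) / r"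
      using r D_alt[OF r(2)] by (simp add: chord_slope_def q_def D_def powr_diff powr_minus field_simps)
    have "(2 * b / (1 - (1 - r)) + (a + b - 1) / (1 - r) + a * V r) * (F' r - a * V r * ?F r)
            + (F'' r - a * V' r * ?F r - a * V r * F' r)
          = - ?e * (a * q r / ((1 - r) * (D r)\<^sup>2)) * ?F r"
    proof (rule wronskian_identity[where p = p])
      show "q r * (1 - (1 - r)) * ?e = b * (1 - q r) * D r - (a - p) * q r * (1 - (1 - r))"
      proof -
        have "q r * r * (chord_slope p (1 - r) - 1) = (1 - q r) * D r"
          unfolding slope D_def using r qpos by (simp add: field_simps)
        then show ?thesis by (simp add: algebra_simps) algebra
      qed
    qed (use r ode[of r] Dpos in \<open>auto simp: D_def V_def V'_def\<close>)
    moreover have "(Z has_real_derivative W r * M r * ((2 * b / r + (a + b - 1) / (1 - r) + a * V r) * (F' r - a * V r * ?F r)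
            + (F'' r - a * V' r * ?F r - a * V r * F' r))) (at r)"
      unfolding Z_def[abs_def]
      by (rule DERIV_cong, (rule DERIV_mult W_deriv M_deriv S_deriv r less_imp_le)+) (unfold S_def, algebra)
    ultimately have "(Z has_real_derivative - ?e * (W r * M r * (a * q r / ((1 - r) * (D r)\<^sup>2))) * ?F r) (at r)"
      by (simp add: mult_ac)
    moreover have "W r * M r * (a * q r / ((1 - r) * (D r)\<^sup>2)) > 0"
      using Wpos Mpos[OF r(2)] qpos r assms Dpos[OF r(2)] by simp
    ultimately show "\<exists>k>0. (Z has_real_derivative - ?e * k * ?F r) (at r)" by blast
  qed
qed

text \<open>The ratio is continuous up to 1, so its comparisons may end there; those of
  \<open>Z\<close> stop before 1. Positivity of \<open>F\<close> is a local premise because the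
  proof of that positivity relies on this lemma.\<close>

lemma mean_ratio_wronskian_monotone:
  fixes a b p :: real
  defines "F \<equiv> hyp2F1 (- a) b (2 * b)"
  defines "e \<equiv> (\<lambda>r. b * (chord_slope p (1 - r) - 1) - (a - p))"
  assumes "a > 1" "b > 0" "p \<ge> 1"
  obtains Z :: "real \<Rightarrow> real" where "Z 0 = 0"
    "\<And>s t. 0 \<le> s \<Longrightarrow> s < t \<Longrightarrow> t \<le> 1 \<Longrightarrow> (\<And>u. s < u \<Longrightarrow> u < t \<Longrightarrow> Z u > 0) \<Longrightarrow>
       mean_ratio a b p s < mean_ratio a b p t"
    "\<And>s t. 0 \<le> s \<Longrightarrow> s < t \<Longrightarrow> t \<le> 1 \<Longrightarrow> (\<And>u. s < u \<Longrightarrow> u < t \<Longrightarrow> Z u < 0) \<Longrightarrow>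
       mean_ratio a b p t < mean_ratio a b p s"
    "\<And>s t. 0 \<le> s \<Longrightarrow> s < t \<Longrightarrow> t < 1 \<Longrightarrow> (\<And>u. s < u \<Longrightarrow> u < t \<Longrightarrow> F u > 0 \<and> e u < 0) \<Longrightarrow> Z s < Z t"
    "\<And>s t. 0 \<le> s \<Longrightarrow> s < t \<Longrightarrow> t < 1 \<Longrightarrow> (\<And>u. s < u \<Longrightarrow> u < t \<Longrightarrow> F u > 0 \<and> e u > 0) \<Longrightarrow> Z t < Z s"
proof -
  obtain Z where Z: "continuous_on {0..<1} Z" "Z 0 = 0"
    and ratio_deriv:
      "\<And>r. 0 < r \<Longrightarrow> r < 1 \<Longrightarrow> \<exists>k>0. (mean_ratio a b p has_real_derivative k * Z r) (at r)"
    and Z_deriv: "\<And>r. 0 < r \<Longrightarrow> r < 1 \<Longrightarrow> \<exists>k>0. (Z has_real_derivative - e r * k * F r) (at r)"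
    unfolding e_def F_def using mean_ratio_wronskian[OF assms(3-5)] by metis
  have Z_cont: "continuous_on {s..t} Z" if "0 \<le> s" "t < 1" for s t
    by (rule continuous_on_subset[OF Z(1)]) (use that in auto)
  have ratio_cont: "continuous_on {s..t} (mean_ratio a b p)" if "0 \<le> s" "t \<le> 1" for s t
    by (rule continuous_on_subset[OF continuous_on_mean_ratio[OF assms(3-5)]]) (use that in auto)
  show ?thesis
  proof
    fix s t :: real assume st: "0 \<le> s" "s < t" "t \<le> 1"
    have *: "\<exists>k>0. (mean_ratio a b p has_real_derivative k * Z u) (at u)" if "s < u" "u < t" for u
      using that st by (intro ratio_deriv) auto
    show "mean_ratio a b p s < mean_ratio a b p t" if "\<And>u. s < u \<Longrightarrow> u < t \<Longrightarrow> Z u > 0"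
    proof (rule DERIV_pos_imp_increasing_open[OF st(2) _ ratio_cont[OF st(1,3)]])
      fix u assume u: "s < u" "u < t"
      from *[OF u] that[OF u]
      show "\<exists>y. (mean_ratio a b p has_real_derivative y) (at u) \<and> y > 0"
        by (meson mult_pos_pos)
    qed
    show "mean_ratio a b p t < mean_ratio a b p s" if "\<And>u. s < u \<Longrightarrow> u < t \<Longrightarrow> Z u < 0"
    proof (rule DERIV_neg_imp_decreasing_open[OF st(2) _ ratio_cont[OF st(1,3)]])
      fix u assume u: "s < u" "u < t"
      from *[OF u] that[OF u]
      show "\<exists>y. (mean_ratio a b p has_real_derivative y) (at u) \<and> y < 0"
        by (meson mult_pos_neg)
    qed
  next
    fix s t :: real assume st: "0 \<le> s" "s < t" "t < 1"
    have *: "\<exists>k>0. (Z has_real_derivative - e u * k * F u) (at u)" if "s < u" "u < t" for u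
      using that st by (intro Z_deriv) auto
    show "Z s < Z t" if sgn: "\<And>u. s < u \<Longrightarrow> u < t \<Longrightarrow> F u > 0 \<and> e u < 0"
    proof (rule DERIV_pos_imp_increasing_open[OF st(2) _ Z_cont[OF st(1,3)]])
      fix u assume u: "s < u" "u < t"
      with * obtain k where k: "k > 0" "(Z has_real_derivative - e u * k * F u) (at u)" by blast
      have "- e u * k * F u > 0" using k(1) sgn[OF u] by (intro mult_pos_pos) auto
      with k(2) show "\<exists>y. (Z has_real_derivative y) (at u) \<and> y > 0" by blast
    qed
    show "Z t < Z s" if sgn: "\<And>u. s < u \<Longrightarrow> u < t \<Longrightarrow> F u > 0 \<and> e u > 0"
    proof (rule DERIV_neg_imp_decreasing_open[OF st(2) _ Z_cont[OF st(1,3)]])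
      fix u assume u: "s < u" "u < t"
      with * obtain k where k: "k > 0" "(Z has_real_derivative - e u * k * F u) (at u)" by blast
      have "- e u * k * F u < 0" using k(1) sgn[OF u] by (intro mult_neg_pos) auto
      with k(2) show "\<exists>y. (Z has_real_derivative y) (at u) \<and> y < 0" by blast
    qed
  qed (rule Z(2))
qed

section \<open>Comparing the ratio with 1\<close>

text \<open>\<open>Z\<close> rises from 0 and is therefore positive, so the ratio rises from 1.
  Positivity is required only before \<open>x\<close>, which suits an argument by a first
  zero.\<close>

lemma mean_ratio_gt_1:
  assumes "a > 1" "b > 0" "p \<ge> 1" "0 < x" "x \<le> 1"
    and pos: "\<And>r. 0 < r \<Longrightarrow> r < x \<Longrightarrow> hyp2F1 (- a) b (2 * b) r > 0"
    and slope: "\<And>r. 0 < r \<Longrightarrow> r < x \<Longrightarrow> b * (chord_slope p (1 - r) - 1) < a - p"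
  shows "mean_ratio a b p x > 1"
proof (rule mean_ratio_wronskian_monotone[OF assms(1-3)])
  fix Z :: "real \<Rightarrow> real"
  assume Z0: "Z 0 = 0"
    and ratio_incr: "\<And>s t. 0 \<le> s \<Longrightarrow> s < t \<Longrightarrow> t \<le> 1 \<Longrightarrow> (\<And>u. s < u \<Longrightarrow> u < t \<Longrightarrow> Z u > 0) \<Longrightarrow>
       mean_ratio a b p s < mean_ratio a b p t"
    and Z_incr: "\<And>s t. 0 \<le> s \<Longrightarrow> s < t \<Longrightarrow> t < 1 \<Longrightarrow> (\<And>u. s < u \<Longrightarrow> u < t \<Longrightarrow>
       hyp2F1 (- a) b (2 * b) u > 0 \<and> b * (chord_slope p (1 - u) - 1) - (a - p) < 0) \<Longrightarrow> Z s < Z t"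
  have "Z u > 0" if "0 < u" "u < x" for u
    using Z_incr[of 0 u] pos slope that assms(5) by (simp add: Z0)
  then have "mean_ratio a b p 0 < mean_ratio a b p x"
    using assms by (intro ratio_incr) auto
  then show ?thesis by (simp add: mean_ratio_0)
qed

text \<open>Up to a first zero, the function would dominate the \<open>a\<close>-th power of the arithmetic mean.\<close>
lemma hyp2F1_pos:
  assumes "a > 1" "b > 0" "0 \<le> r" "r \<le> 1"
  shows "hyp2F1 (- a) b (2 * b) r > 0"
proof (rule ccontr)
  let ?F = "hyp2F1 (- a) b (2 * b)"
  define N where "N = {x \<in> {0..1}. ?F x \<le> 0}"
  assume "\<not> ?F r > 0"
  then have "N \<noteq> {}" using assms by (auto simp: N_def)
  have "closed N"
    unfolding N_def using assms
    by (intro continuous_on_closed_Collect_le continuous_on_hyp2F1 continuous_on_const) auto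
  moreover have bdd: "bdd_below N" by (auto simp: N_def)
  ultimately have "Inf N \<in> N"
    using \<open>N \<noteq> {}\<close> by (intro closed_contains_Inf)
  define x where "x = Inf N"
  have x: "0 \<le> x" "x \<le> 1" "?F x \<le> 0"
    using \<open>Inf N \<in> N\<close> by (auto simp: N_def x_def)
  have "?F 0 = 1" by (simp add: hyp2F1_def eval_fps_at_0 del: fps_hypergeo_nth)
  then have "x > 0" using x by (cases "x = 0") auto
  \<comment> \<open>The function is positive before its first nonpositive point \<open>x\<close>, so
    the ratio of order 1 exceeds 1 at \<open>x\<close>, although its numerator there is
    nonpositive.\<close>
  have "mean_ratio a b 1 x > 1"
  proof (rule mean_ratio_gt_1)
    fix s assume s: "0 < s" "s < x"
    show "?F s > 0"
    proof (rule ccontr)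
      assume "\<not> ?F s > 0"
      then have "s \<in> N" using s x by (auto simp: N_def)
      then show False using cInf_lower[OF _ bdd, of s] s by (simp add: x_def)
    qed
    show "b * (chord_slope 1 (1 - s) - 1) < a - 1"
      using s x assms by (simp add: chord_slope_1)
  qed (use assms x \<open>x > 0\<close> in auto)
  moreover have "mean_ratio a b 1 x \<le> 0"
    using x by (simp add: mean_ratio_def divide_nonpos_nonneg)
  ultimately show False by simp
qed

lemma mean_ratio_lt_1:
  assumes "a > 1" "b > 0" "p \<ge> 1" "0 < x" "x \<le> 1"
    and slope: "\<And>r. 0 < r \<Longrightarrow> r < x \<Longrightarrow> b * (chord_slope p (1 - r) - 1) > a - p"
  shows "mean_ratio a b p x < 1"
proof (rule mean_ratio_wronskian_monotone[OF assms(1-3)])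
  fix Z :: "real \<Rightarrow> real"
  assume Z0: "Z 0 = 0"
    and ratio_decr: "\<And>s t. 0 \<le> s \<Longrightarrow> s < t \<Longrightarrow> t \<le> 1 \<Longrightarrow> (\<And>u. s < u \<Longrightarrow> u < t \<Longrightarrow> Z u < 0) \<Longrightarrow>
       mean_ratio a b p t < mean_ratio a b p s"
    and Z_decr: "\<And>s t. 0 \<le> s \<Longrightarrow> s < t \<Longrightarrow> t < 1 \<Longrightarrow> (\<And>u. s < u \<Longrightarrow> u < t \<Longrightarrow>
       hyp2F1 (- a) b (2 * b) u > 0 \<and> b * (chord_slope p (1 - u) - 1) - (a - p) > 0) \<Longrightarrow> Z t < Z s"
  have "Z u < 0" if "0 < u" "u < x" for u
    using Z_decr[of 0 u] hyp2F1_pos[OF assms(1,2)] slope that assms(5) by (simp add: Z0)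
  then have "mean_ratio a b p x < mean_ratio a b p 0"
    using assms by (intro ratio_decr) auto
  then show ?thesis by (simp add: mean_ratio_0)
qed

text \<open>If \<open>Z\<close> is positive at \<open>x\<close>, it is positive on all of \<open>(0, x)\<close> and the ratio increases from \<open>0\<close> to
  \<open>x\<close>; otherwise \<open>Z\<close> is already decreasing at \<open>x\<close> and the ratio decreases from \<open>x\<close> to \<open>1\<close>.\<close>
lemma mean_ratio_gt_1_of_endpoint:
  assumes "a > 1" "b > 0" "p > 1" "0 < x" "x < 1" and endpoint: "mean_ratio a b p 1 = 1"
  shows "mean_ratio a b p x > 1"
proof (rule mean_ratio_wronskian_monotone[OF assms(1,2) less_imp_le[OF assms(3)]])
  let ?e = "\<lambda>r. b * (chord_slope p (1 - r) - 1) - (a - p)"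
  fix Z :: "real \<Rightarrow> real"
  assume Z0: "Z 0 = 0"
    and ratio_incr: "\<And>s t. 0 \<le> s \<Longrightarrow> s < t \<Longrightarrow> t \<le> 1 \<Longrightarrow> (\<And>u. s < u \<Longrightarrow> u < t \<Longrightarrow> Z u > 0) \<Longrightarrow>
       mean_ratio a b p s < mean_ratio a b p t"
    and ratio_decr: "\<And>s t. 0 \<le> s \<Longrightarrow> s < t \<Longrightarrow> t \<le> 1 \<Longrightarrow> (\<And>u. s < u \<Longrightarrow> u < t \<Longrightarrow> Z u < 0) \<Longrightarrow>
       mean_ratio a b p t < mean_ratio a b p s"
    and Z_incr: "\<And>s t. 0 \<le> s \<Longrightarrow> s < t \<Longrightarrow> t < 1 \<Longrightarrow> (\<And>u. s < u \<Longrightarrow> u < t \<Longrightarrow>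
       hyp2F1 (- a) b (2 * b) u > 0 \<and> ?e u < 0) \<Longrightarrow> Z s < Z t"
    and Z_decr: "\<And>s t. 0 \<le> s \<Longrightarrow> s < t \<Longrightarrow> t < 1 \<Longrightarrow> (\<And>u. s < u \<Longrightarrow> u < t \<Longrightarrow>
       hyp2F1 (- a) b (2 * b) u > 0 \<and> ?e u > 0) \<Longrightarrow> Z t < Z s"
  have F: "hyp2F1 (- a) b (2 * b) u > 0" if "0 \<le> u" "u < 1" for u
    using assms that by (intro hyp2F1_pos) auto
  \<comment> \<open>\<open>1 - r\<close> decreases in \<open>r\<close>, so \<open>?e\<close>
    increases: \<open>Z\<close> can only turn from increasing to decreasing.\<close>
  have e_mono: "?e s < ?e t" if "0 < s" "s < t" "t < 1" for s t
    using chord_slope_strict_decreasing[of p "1 - t" "1 - s"] that assms by simp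
  have Z_pos: "Z t > 0" if "0 < t" "t < 1" "?e t < 0" for t
  proof -
    have "Z 0 < Z t"
      using that by (intro Z_incr conjI F) (auto dest: e_mono[of _ t])
    then show ?thesis by (simp add: Z0)
  qed
  have Z_less: "Z t < Z s" if "0 < s" "s < t" "t < 1" "?e s \<ge> 0" for s t
  proof (rule Z_decr, goal_cases)
    case (4 u)
    then show ?case using e_mono[of s u] F[of u] that by linarith
  qed (use that in auto)
  show ?thesis
  proof (rule ccontr)
    assume le: "\<not> mean_ratio a b p x > 1"
    show False
    proof (cases "Z x > 0")
      case True
      \<comment> \<open>If \<open>?e u\<close> is negative, \<open>Z\<close> has been increasing
        from 0 up to \<open>u\<close>; otherwise it decreases from \<open>u\<close> to
        \<open>x\<close> and \<open>Z u\<close> exceeds the positive \<open>Z x\<close>.\<close>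
      have "Z u > 0" if "0 < u" "u < x" for u
        using Z_pos[of u] Z_less[of u x] True that assms by linarith
      then have "mean_ratio a b p 0 < mean_ratio a b p x"
        using assms by (intro ratio_incr) auto
      then show False using le by (simp add: mean_ratio_0)
    next
      case False
      then have "?e x \<ge> 0" using Z_pos[of x] assms by linarith
      then have "Z u < 0" if "x < u" "u < 1" for u
        using Z_less[of x u] False that assms by linarith
      then have "mean_ratio a b p 1 < mean_ratio a b p x"
        using assms by (intro ratio_decr) auto
      then show False using le endpoint by simp
    qed
  qed
qed

section \<open>Return to the means and the two critical orders\<close>

lemma mean_ratio_eq:
  assumes "a > 1" "b > 0" "p \<ge> 1" "0 \<le> r" "r \<le> 1"
  shows "mean_ratio a b p r = (hyp2F1 (- a) b (2 * b) r powr (1 / a) / power_mean p (1/2) (1 - r)) powr a"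
  using hyp2F1_pos[of a b r] assms
  by (simp only: mean_ratio_def half_power_mean_eq powr_divide powr_powr) simp

lemma mean_ratio_compare:
  assumes "a > 1" "b > 0" "p \<ge> 1" "0 < r" "r < 1"
  shows "mean_ratio a b p r > 1 \<longleftrightarrow> power_mean p (1/2) (1 - r) < hyp2F1 (- a) b (2 * b) r powr (1 / a)"
    and "mean_ratio a b p r < 1 \<longleftrightarrow> hyp2F1 (- a) b (2 * b) r powr (1 / a) < power_mean p (1/2) (1 - r)"
proof -
  let ?x = "hyp2F1 (- a) b (2 * b) r powr (1 / a)" and ?y = "power_mean p (1/2) (1 - r)"
  have "?y > 0"
    using assms by (simp add: power_mean_def add_pos_nonneg less_imp_neq[THEN not_sym])
  have "?x > 0" using hyp2F1_pos[of a b r] assms by simp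
  have 1: "t powr a > 1 \<longleftrightarrow> t > 1" "t powr a < 1 \<longleftrightarrow> t < 1" if "t > 0" for t
    using that assms
    by (simp_all flip: ln_gt_zero_iff ln_less_zero_iff add: ln_powr zero_less_mult_iff mult_less_0_iff)
  show "mean_ratio a b p r > 1 \<longleftrightarrow> ?y < ?x" "mean_ratio a b p r < 1 \<longleftrightarrow> ?x < ?y"
    using mean_ratio_eq[of a b p r] 1[of "?x / ?y"] \<open>?x > 0\<close> \<open>?y > 0\<close> assms
    by (simp_all add: divide_less_eq_1 less_divide_eq_1)
qed

text \<open>\<open>p_0\<close> is the order at which the sign criterion vanishes in the limit
  \<open>r = 0\<close>. The chord slope stays strictly above its limit, so the criterion has one
  sign throughout.\<close>

lemma mean_ratio_p_0_lt_1:
  assumes "a > 1" "b > 0" "0 < x" "x \<le> 1"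
  shows "mean_ratio a b (p_0 a (2 * b)) x < 1"
proof (rule mean_ratio_lt_1)
  let ?p = "p_0 a (2 * b)"
  have p: "?p > 1" "a - ?p = 2 * b * (?p - 1)"
    using assms by (simp_all add: p_0_def field_simps)
  then show "?p \<ge> 1" by simp
  fix r assume "0 < r" "r < x"
  then have "chord_slope ?p (1 - r) > 2 * ?p - 1"
    using assms p by (intro chord_slope_gt) auto
  then have "b * (chord_slope ?p (1 - r) - 1) > b * (2 * ?p - 1 - 1)"
    using assms by simp
  then show "b * (chord_slope ?p (1 - r) - 1) > a - ?p"
    unfolding p(2) by (simp add: algebra_simps)
qed (use assms in auto)

text \<open>Optimality of \<open>p_0\<close>: below it the criterion has the opposite sign near
  \<open>r = 0\<close>.\<close>

lemma mean_ratio_gt_1_near_0: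
  assumes "a > 1" "b > 0" "p \<ge> 1" "p < p_0 a (2 * b)"
  obtains x where "0 < x" "x < 1" "mean_ratio a b p x > 1"
proof -
  have "2 * p - 1 < 1 + (a - p) / b"
    using assms by (simp add: p_0_def field_simps)
  then have "\<forall>\<^sub>F h in at_left 1. chord_slope p h < 1 + (a - p) / b"
    using tendsto_chord_slope by (rule order_tendstoD(2)[rotated])
  then obtain y where y: "y < 1" "\<And>h. y < h \<Longrightarrow> h < 1 \<Longrightarrow> chord_slope p h < 1 + (a - p) / b"
    by (auto simp: eventually_at_left_field)
  \<comment> \<open>The bound \<open>1 / 2\<close> keeps \<open>x\<close> below 1, since
    \<open>y\<close> need not be positive.\<close>
  define x where "x = min (1 - y) (1 / 2)"
  have x: "0 < x" "x < 1" "x \<le> 1 - y" using y by (auto simp: x_def)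
  moreover have "mean_ratio a b p x > 1"
  proof (rule mean_ratio_gt_1)
    fix r assume r: "0 < r" "r < x"
    show "hyp2F1 (- a) b (2 * b) r > 0" using r x assms by (intro hyp2F1_pos) auto
    have "chord_slope p (1 - r) < 1 + (a - p) / b" using r x by (intro y) auto
    then show "b * (chord_slope p (1 - r) - 1) < a - p"
      using assms by (simp add: field_simps)
  qed (use assms x in auto)
  ultimately show ?thesis using that by blast
qed

lemma mean_ratio_1_gt_1:
  assumes "a > 1" "b > 0"
  shows "mean_ratio a b 1 1 > 1"
proof (rule mean_ratio_gt_1)
  fix r :: real assume "0 < r" "r < 1"
  then show "hyp2F1 (- a) b (2 * b) r > 0" "b * (chord_slope 1 (1 - r) - 1) < a - 1"
    using assms by (auto intro: hyp2F1_pos simp: chord_slope_1)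
qed (use assms in auto)

text \<open>\<open>ln (C * 2 powr (a / p))\<close> decreases in \<open>p > 0\<close> and vanishes at
  \<open>p_E\<close>. The endpoint values of the ratio show that it is positive at order 1 and
  negative at \<open>p_0\<close>.\<close>

lemma p_E_bounds:
  assumes "a > 1" "b > 0"
  shows "1 < p_E a b (2 * b)" "p_E a b (2 * b) < p_0 a (2 * b)"
    and "C_a a b (2 * b) * 2 powr (a / p_E a b (2 * b)) = 1"
proof -
  let ?C = "C_a a b (2 * b)" and ?p = "p_0 a (2 * b)"
  define L where "L = - ln ?C"
  have p: "?p > 1" using assms by (simp add: p_0_def field_simps)
  have C: "?C > 0"
    using hyp2F1_pos[of a b 1] hyp2F1_at_1[of a b "2 * b"] assms by simp
  have ln: "ln (?C * 2 powr s) = s * ln 2 - L" for s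
    using C by (simp add: L_def ln_mult ln_powr)
  have "?C * 2 powr a > 1"
    using mean_ratio_1_gt_1[OF assms] assms by (simp add: mean_ratio_1)
  then have "ln (?C * 2 powr a) > 0" by simp
  then have L1: "L < a * ln 2" by (simp add: ln)
  have "?C * 2 powr (a / ?p) < 1"
    using mean_ratio_p_0_lt_1[of a b 1] assms p by (simp add: mean_ratio_1)
  then have "ln (?C * 2 powr (a / ?p)) < 0" using C by simp
  then have L2: "a * ln 2 / ?p < L" by (simp add: ln)
  moreover have "a * ln 2 / ?p > 0" using assms p by simp
  ultimately have "L > 0" by linarith
  have E: "p_E a b (2 * b) = a * ln 2 / L"
    using assms by (simp add: p_E_def weight_def L_def ln_div)
  show "1 < p_E a b (2 * b)"
    unfolding E using L1 \<open>L > 0\<close> by simp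
  show "p_E a b (2 * b) < ?p"
    unfolding E using L2 \<open>L > 0\<close> p by (simp add: field_simps)
  have "ln (?C * 2 powr (a / p_E a b (2 * b))) = 0"
    unfolding ln E using assms by simp
  then show "?C * 2 powr (a / p_E a b (2 * b)) = 1"
    using C by simp
qed

section \<open>The inequalities and their sharpness\<close>

theorem theorem1p2:
  fixes a b c :: real
  assumes "a > 1" and "b > 0" and "c = 2 * b"
  shows "(1 < p_E a b c \<and> p_E a b c < p_0 a c \<and> p_0 a c < a) \<and>
    (\<forall>lam mu :: real.
       (\<forall>r\<in>{0<..<1}.
          power_mean lam (1/2) (1 - r) \<le> hyp2F1 (-a) b (2 * b) r powr (1 / a) \<and>
          hyp2F1 (-a) b (2 * b) r powr (1 / a) \<le> power_mean mu (1/2) (1 - r))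
       \<longleftrightarrow> lam \<le> p_E a b c \<and> mu \<ge> p_0 a c) \<and>
    (\<forall>r\<in>{0<..<1}.
       power_mean (p_E a b c) (1/2) (1 - r) < hyp2F1 (-a) b (2 * b) r powr (1 / a) \<and>
       hyp2F1 (-a) b (2 * b) r powr (1 / a) < power_mean (p_0 a c) (1/2) (1 - r))"
proof -
  let ?G = "\<lambda>r. hyp2F1 (- a) b (2 * b) r powr (1 / a)"
  let ?A = "\<lambda>p r. power_mean p (1/2) (1 - r)"
  note ab = assms(1,2)
  note E = p_E_bounds[OF ab, folded assms(3)]
  have p0: "p_0 a c < a"
    using assms by (simp add: p_0_def field_simps)
  have lower: "?A (p_E a b c) r < ?G r" if "0 < r" "r < 1" for r
  proof -
    have "mean_ratio a b (p_E a b c) r > 1"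
      using mean_ratio_gt_1_of_endpoint[of a b "p_E a b c" r] mean_ratio_1[of a b "p_E a b c"] E that assms
      by simp
    then show ?thesis
      using E that assms by (simp add: mean_ratio_compare)
  qed
  have upper: "?G r < ?A (p_0 a c) r" if "0 < r" "r < 1" for r
    using mean_ratio_p_0_lt_1[of a b r] E that assms by (simp add: mean_ratio_compare)
  \<comment> \<open>Let \<open>r\<close> tend to 1: the ratio of order \<open>lam\<close> would be
    at least 1 at the endpoint, but its endpoint value is strictly decreasing in the order and
    equals 1 at \<open>p_E\<close>.\<close>
  have lam_le: "lam \<le> p_E a b c" if le: "\<And>r. 0 < r \<Longrightarrow> r < 1 \<Longrightarrow> ?A lam r \<le> ?G r" for lam
  proof (rule ccontr)
    assume "\<not> lam \<le> p_E a b c"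
    then have lam: "lam > p_E a b c" "lam \<ge> 1" using E by auto
    have "(mean_ratio a b lam \<longlongrightarrow> mean_ratio a b lam 1) (at_left 1)"
      using continuous_on_mean_ratio[OF ab lam(2)] by (rule continuous_on_Icc_at_leftD) simp
    moreover have "\<forall>\<^sub>F r in at_left 1. mean_ratio a b lam r \<ge> 1"
      using eventually_at_left_real[OF zero_less_one]
    proof eventually_elim
      case (elim r)
      then show ?case
        using mean_ratio_compare(2)[OF ab lam(2), of r] le[of r] by force
    qed
    ultimately have "mean_ratio a b lam 1 \<ge> 1"
      by (intro tendsto_lowerbound) auto
    then have "C_a a b c * 2 powr (a / lam) \<ge> C_a a b c * 2 powr (a / p_E a b c)"
      using mean_ratio_1[OF ab lam(2)] E(3) assms(3) by simp
    moreover have "C_a a b c > 0"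
      using E(3) zero_less_mult_pos2[of "C_a a b c" "2 powr (a / p_E a b c)"] by simp
    ultimately have "a / lam \<ge> a / p_E a b c" by simp
    moreover have "a / lam < a / p_E a b c"
      using lam E assms by (intro divide_strict_left_mono) auto
    ultimately show False by simp
  qed
  have mu_ge: "mu \<ge> p_0 a c" if le: "\<And>r. 0 < r \<Longrightarrow> r < 1 \<Longrightarrow> ?G r \<le> ?A mu r" for mu
  proof (rule ccontr)
    assume "\<not> mu \<ge> p_0 a c"
    \<comment> \<open>The ratio is studied for orders at least 1 only, while \<open>mu\<close> is
      arbitrary. Raising \<open>mu\<close> to at least 1 enlarges the mean and stays below
      \<open>p_0\<close>, because \<open>1 < p_0\<close>.\<close>
    then have p: "max mu 1 \<ge> 1" "max mu 1 < p_0 a (2 * b)" using E assms by auto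
    then obtain x where x: "0 < x" "x < 1" "mean_ratio a b (max mu 1) x > 1"
      using mean_ratio_gt_1_near_0[OF ab] by metis
    then have "?A (max mu 1) x < ?G x"
      using mean_ratio_compare(1)[OF ab p(1)] by simp
    also have "\<dots> \<le> ?A mu x" using le x by simp
    also have "\<dots> \<le> ?A (max mu 1) x" using x by (intro half_power_mean_mono) auto
    finally show False by simp
  qed
  have sharp: "(\<forall>r\<in>{0<..<1}. ?A lam r \<le> ?G r \<and> ?G r \<le> ?A mu r) \<longleftrightarrow> lam \<le> p_E a b c \<and> mu \<ge> p_0 a c"
    for lam mu
  proof (intro iffI conjI ballI)
    assume *: "lam \<le> p_E a b c \<and> mu \<ge> p_0 a c"
    fix r :: real assume r: "r \<in> {0<..<1}"
    then have "?A lam r \<le> ?A (p_E a b c) r" "?A (p_0 a c) r \<le> ?A mu r"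
      using * by (auto intro!: half_power_mean_mono)
    then show "?A lam r \<le> ?G r" "?G r \<le> ?A mu r"
      using lower[of r] upper[of r] r by auto
  qed (auto intro!: lam_le mu_ge)
  show ?thesis
    using E(1,2) p0 sharp lower upper by simp
qed

end
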